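(* Let $G$ be a topological group whose topology is nontrivial (i.e., not indiscrete), with unit $e$. Then the property $\binom{\mathcal{O}(e)}{\Omega}$ fails for $G$; that is, it is not the case that every member of $\mathcal{O}(e)$ has a subset which is a member of $\Omega$.
   Context: A cover of a set $X$ is a family $\mathcal{U}$ of subsets of $X$ with $X\notin\mathcal{U}$ and $X=\bigcup\mathcal{U}$. A cover $\mathcal{U}$ of $X$ is an $\omega$-cover if each finite $F\subseteq X$ is contained in some $U\in\mathcal{U}$. $\Omega$ denotes the family of all $\omega$-covers of $G$ consisting of open sets. For an open neighborhood $U\neq G$ of $e$, let $o(U)=\{gU : g\in G\}$; $\mathcal{O}(e)$ is the collection of all covers $o(U)$, where $U$ ranges over the open neighborhoods $U\ne G$ of $e$. For collections $\mathscr{A},\mathscr{B}$ of covers, $\binom{\mathscr{A}}{\mathscr{B}}$ is the statement: every member of $\mathscr{A}$ has a subset (subfamily) which is a member of $\mathscr{B}$. *)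

theory Defs
  imports "HOL-Algebra.Coset" "HOL-Analysis.Product_Topology"
begin

text \<open>No separation axiom is assumed of a topological group.\<close>

locale topological_group = group G for G (structure) +
  fixes T :: "'a topology"
  assumes topspace_eq_carrier: "topspace T = carrier G"
    and continuous_mult: "continuous_map (prod_topology T T) T (\<lambda>(x, y). x \<otimes> y)"
    and continuous_inv: "continuous_map T T (\<lambda>x. inv x)"

definition indiscrete :: "'a topology \<Rightarrow> bool" where
  "indiscrete T \<longleftrightarrow> (\<forall>U. openin T U \<longrightarrow> U = {} \<or> U = topspace T)"

definition is_cover :: "'a set \<Rightarrow> 'a set set \<Rightarrow> bool" where
  "is_cover X \<U> \<longleftrightarrow> \<U> \<subseteq> Pow X \<and> X \<notin> \<U> \<and> X = \<Union>\<U>"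

definition is_omega_cover :: "'a set \<Rightarrow> 'a set set \<Rightarrow> bool" where
  "is_omega_cover X \<U> \<longleftrightarrow>
     is_cover X \<U> \<and> (\<forall>F. finite F \<and> F \<subseteq> X \<longrightarrow> (\<exists>U\<in>\<U>. F \<subseteq> U))"

definition open_omega_covers :: "'a topology \<Rightarrow> 'a set set set" where
  "open_omega_covers T = {\<U>. is_omega_cover (topspace T) \<U> \<and> (\<forall>U\<in>\<U>. openin T U)}"

definition translates :: "('a, 'b) monoid_scheme \<Rightarrow> 'a set \<Rightarrow> 'a set set" where
  "translates G U = {g <#\<^bsub>G\<^esub> U | g. g \<in> carrier G}"

text \<open>In a topological group, the translates of a proper neighborhood of the unit are
  proper subsets and cover the group, so the members of the following collection are covers.\<close>

definition nbhd_covers :: "('a, 'b) monoid_scheme \<Rightarrow> 'a topology \<Rightarrow> 'a set set set" where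
  "nbhd_covers G T =
     {translates G U | U. openin T U \<and> \<one>\<^bsub>G\<^esub> \<in> U \<and> U \<noteq> carrier G}"

text \<open>The property written $\binom{\mathscr{A}}{\mathscr{B}}$.\<close>

definition has_subcovers :: "'a set set set \<Rightarrow> 'a set set set \<Rightarrow> bool" where
  "has_subcovers \<A> \<B> \<longleftrightarrow> (\<forall>\<U>\<in>\<A>. \<exists>\<V>. \<V> \<subseteq> \<U> \<and> \<V> \<in> \<B>)"

end

theory Submission
  imports Defs
begin

text \<open>The obstruction to an \<open>\<omega>\<close>-subcover is a two-point set. Let \<open>O'\<close> be an open set with
  \<open>x \<in> O'\<close> and \<open>y \<notin> O'\<close>. By continuity of the operations there is an open neighborhood \<open>V\<close>
  of the unit so small that \<open>x V\<inverse> V \<subseteq> O'\<close>. If a translate \<open>g V\<close> contained both \<open>x = g u\<close> and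
  \<open>y = g v\<close>, then \<open>y = x u\<inverse> v \<in> x V\<inverse> V \<subseteq> O'\<close>, a contradiction. So no translate of \<open>V\<close>
  contains \<open>{x, y}\<close>, and no family of translates of \<open>V\<close> is an \<open>\<omega>\<close>-cover. The same fact shows
  that \<open>V\<close>, being its own translate by the unit, is not the whole group.\<close>

context topological_group
begin

text \<open>The map \<open>(u, v) \<mapsto> x u\<inverse> v\<close> is continuous and sends \<open>(\<one>, \<one>)\<close> to \<open>x\<close>, so it
  sends some open box \<open>A \<times> B\<close> around \<open>(\<one>, \<one>)\<close> into \<open>O'\<close>; intersecting the two sides
  gives \<open>V\<close>.\<close>

lemma small_neighborhood:
  assumes "openin T O'" and "x \<in> O'"
  obtains V where "openin T V" and "\<one> \<in> V"
    and "\<And>u v. u \<in> V \<Longrightarrow> v \<in> V \<Longrightarrow> x \<otimes> (inv u \<otimes> v) \<in> O'"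
proof -
  have x: "x \<in> topspace T"
    using assms openin_subset by blast
  have mult: "continuous_map X T (\<lambda>z. f z \<otimes> g z)"
    if "continuous_map X T f" "continuous_map X T g" for X :: "('a \<times> 'a) topology" and f g
    using continuous_map_compose[OF continuous_map_pairedI[OF that] continuous_mult]
    by (simp add: o_def)
  have "continuous_map (prod_topology T T) T (\<lambda>z. inv (fst z))"
    using continuous_map_compose[OF continuous_map_fst continuous_inv] by (simp add: o_def)
  then have cont: "continuous_map (prod_topology T T) T (\<lambda>z. x \<otimes> (inv (fst z) \<otimes> snd z))"
    using x by (intro mult continuous_map_snd) auto
  define P where "P = {z \<in> topspace (prod_topology T T). x \<otimes> (inv (fst z) \<otimes> snd z) \<in> O'}"
  have "openin (prod_topology T T) P"
    unfolding P_def by (rule openin_continuous_map_preimage[OF cont assms(1)])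
  moreover have "(\<one>, \<one>) \<in> P"
    using x assms(2) by (simp add: P_def topspace_eq_carrier)
  ultimately obtain A B where AB: "openin T A" "openin T B" "\<one> \<in> A" "\<one> \<in> B" "A \<times> B \<subseteq> P"
    by (metis openin_prod_topology_alt)
  show thesis
  proof
    show "openin T (A \<inter> B)" and "\<one> \<in> A \<inter> B"
      using AB by auto
    show "x \<otimes> (inv u \<otimes> v) \<in> O'" if "u \<in> A \<inter> B" "v \<in> A \<inter> B" for u v
      using AB(5) that by (auto simp: P_def)
  qed
qed

lemma neighborhood_with_translates_missing_pair:
  assumes "openin T O'" and "x \<in> O'" and "y \<in> carrier G" and "y \<notin> O'"
  obtains V where "openin T V" and "\<one> \<in> V"
    and "\<And>g. g \<in> carrier G \<Longrightarrow> \<not> {x, y} \<subseteq> g <# V"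
proof -
  obtain V where V: "openin T V" "\<one> \<in> V"
    and small: "\<And>u v. u \<in> V \<Longrightarrow> v \<in> V \<Longrightarrow> x \<otimes> (inv u \<otimes> v) \<in> O'"
    using small_neighborhood[OF assms(1,2)] by blast
  have sub: "V \<subseteq> carrier G"
    using V(1) openin_subset topspace_eq_carrier by metis
  have "\<not> {x, y} \<subseteq> g <# V" if g: "g \<in> carrier G" for g
  proof
    assume "{x, y} \<subseteq> g <# V"
    then obtain u v where uv: "u \<in> V" "v \<in> V" and eq: "x = g \<otimes> u" "y = g \<otimes> v"
      by (auto simp: l_coset_def)
    have "u \<in> carrier G" "v \<in> carrier G"
      using uv sub by auto
    then have "x \<otimes> (inv u \<otimes> v) = y"
      using g by (simp add: eq m_assoc) (simp flip: m_assoc)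
    then show False
      using small[OF uv] assms(4) by simp
  qed
  with V that show thesis by blast
qed

end

theorem theorem8:
  fixes G :: "('a, 'b) monoid_scheme" and T :: "'a topology"
  assumes "topological_group G T"
    and "\<not> indiscrete T"
  shows "\<not> has_subcovers (nbhd_covers G T) (open_omega_covers T)"
proof
  assume sub: "has_subcovers (nbhd_covers G T) (open_omega_covers T)"
  interpret topological_group G T by fact
  obtain O' where O': "openin T O'" "O' \<noteq> {}" "O' \<noteq> topspace T"
    using assms(2) by (auto simp: indiscrete_def)
  then obtain x y where xy: "x \<in> O'" "y \<in> carrier G" "y \<notin> O'"
    using openin_subset topspace_eq_carrier by blast
  have x: "x \<in> carrier G"
    using O'(1) xy(1) openin_subset topspace_eq_carrier by blast
  obtain V where V: "openin T V" "\<one>\<^bsub>G\<^esub> \<in> V"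
    and miss: "\<And>g. g \<in> carrier G \<Longrightarrow> \<not> {x, y} \<subseteq> g <#\<^bsub>G\<^esub> V"
    using neighborhood_with_translates_missing_pair[OF O'(1) xy] by blast
  have "V \<noteq> carrier G"
  proof
    assume "V = carrier G"
    then have "{x, y} \<subseteq> \<one>\<^bsub>G\<^esub> <#\<^bsub>G\<^esub> V"
      using x xy(2) by (simp add: lcos_mult_one)
    then show False
      using miss by blast
  qed
  with V have "translates G V \<in> nbhd_covers G T"
    by (auto simp: nbhd_covers_def)
  then obtain \<V> where \<V>: "\<V> \<subseteq> translates G V" "is_omega_cover (topspace T) \<V>"
    using sub by (auto simp: has_subcovers_def open_omega_covers_def)
  have "finite {x, y}" "{x, y} \<subseteq> topspace T"
    using x xy(2) topspace_eq_carrier by auto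
  then obtain W where "W \<in> \<V>" "{x, y} \<subseteq> W"
    using \<V>(2) unfolding is_omega_cover_def by blast
  then show False
    using \<V>(1) miss by (auto simp: translates_def)
qed

end
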